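(* Let $H$ be a Hilbert space, let $A\subseteq B(H)$ be a unital $C^*$-subalgebra (containing $I_H$), let $n,m<\infty$ be positive integers, and let $\omega:\mathcal{E}_n\to B(H)$ and $\tau:\mathcal{E}_m\to B(H)$ be nondegenerate $*$-representations such that $$\alpha(a):=\sum_{i=1}^n\omega(v_i)a\omega(v_i)^*,\qquad \beta(a):=\sum_{j=1}^m\tau(v_j)a\tau(v_j)^*$$ are $*$-endomorphisms of $A$. If the relative commutant $A'$ has Invariant Basis Number, then the following are equivalent: (1) $\alpha=\beta$ (as maps on $A$); (2) $n=m$ and $\omega$ and $\tau$ are $A'$-free equivalent.
   Context: The Toeplitz algebra $\mathcal{E}_n$ ($1\le n<\infty$) is the universal unital $C^*$-algebra generated by isometries $v_1,\dots,v_n$ with $v_i^*v_j=\delta_{ij}I$ (the same letters $v_j$ denote the generators of $\mathcal{E}_m$). $A'$ is the commutant of $A$ in $B(H)$. That $\alpha$ is a $*$-endomorphism of $A$ means in particular $\alpha(A)\subseteq A$; it need not be unital. For a unital $C^*$-algebra $D$, $D^n$ is the free right Hilbert $D$-module of rank $n$ with inner product $\langle (a_i),(b_i)\rangle=\sum_i a_i^*b_i$ and standard basis $e_1,\dots,e_n$. $L(X,Y)$ is the space of adjointable $D$-module homomorphisms between Hilbert $D$-modules, $L(X)=L(X,X)$, and $X\simeq Y$ means there is a unitary in $L(X,Y)$. $D$ has Invariant Basis Number (IBN) if $D^n\simeq D^m$ if and only if $n=m$. Let $D\subset B(H)$ be a unital $C^*$-subalgebra (containing $I_H$). For a nondegenerate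 $*$-representation $\omega$ of $\mathcal{E}_n$ on $H$ put $\sigma_\omega(x)=\sum_{i=1}^n\omega(v_i)\langle e_i,x\rangle\in B(H)$ for $x\in D^n$. Two nondegenerate representations $\omega,\tau$ of $\mathcal{E}_n$ on $H$ are $D$-free equivalent if there is a unitary $U\in L(D^n)$ with $\sigma_\omega=\sigma_\tau\circ U$. Here $D=A'$. *)

theory Defs
  imports "HOL-Analysis.Analysis" "HOL-Algebra.Subrings"
begin

section \<open>Complex Hilbert spaces\<close>

text \<open>The inner product is linear in the second variable. Completeness comes from \<open>banach\<close>;
  positive definiteness is part of \<open>cinner_self\<close>.\<close>

class complex_hilbert = banach +
  fixes scaleC :: "complex \<Rightarrow> 'a \<Rightarrow> 'a"  (infixr \<open>*\<^sub>C\<close> 75)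
    and cinner :: "'a \<Rightarrow> 'a \<Rightarrow> complex"
  assumes scaleC_add_right: "c *\<^sub>C (x + y) = c *\<^sub>C x + c *\<^sub>C y"
    and scaleC_add_left: "(c + d) *\<^sub>C x = c *\<^sub>C x + d *\<^sub>C x"
    and scaleC_scaleC: "c *\<^sub>C (d *\<^sub>C x) = (c * d) *\<^sub>C x"
    and scaleC_of_real: "complex_of_real r *\<^sub>C x = r *\<^sub>R x"
    and cinner_commute: "cinner x y = cnj (cinner y x)"
    and cinner_add_right: "cinner x (y + z) = cinner x y + cinner x z"
    and cinner_scaleC_right: "cinner x (c *\<^sub>C y) = c * cinner x y"
    and cinner_self: "cinner x x = complex_of_real ((norm x)\<^sup>2)"


section \<open>Unital \<open>C\<^sup>*\<close>-algebras\<close>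

record 'a cstar = "'a ring" +
  scal :: "complex \<Rightarrow> 'a \<Rightarrow> 'a"
  star :: "'a \<Rightarrow> 'a"
  cnorm :: "'a \<Rightarrow> real"

text \<open>The zero algebra is admitted.\<close>

locale unital_cstar_algebra = ring A for A :: "('a, 'z) cstar_scheme" (structure) +
  assumes scal_closed: "a \<in> carrier A \<Longrightarrow> scal A c a \<in> carrier A"
    and scal_add_right: "\<lbrakk>a \<in> carrier A; b \<in> carrier A\<rbrakk>
          \<Longrightarrow> scal A c (a \<oplus> b) = scal A c a \<oplus> scal A c b"
    and scal_add_left: "a \<in> carrier A \<Longrightarrow> scal A (c + d) a = scal A c a \<oplus> scal A d a"
    and scal_scal: "a \<in> carrier A \<Longrightarrow> scal A c (scal A d a) = scal A (c * d) a"
    and scal_one: "a \<in> carrier A \<Longrightarrow> scal A 1 a = a"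
    and scal_mult_left: "\<lbrakk>a \<in> carrier A; b \<in> carrier A\<rbrakk>
          \<Longrightarrow> scal A c a \<otimes> b = scal A c (a \<otimes> b)"
    and scal_mult_right: "\<lbrakk>a \<in> carrier A; b \<in> carrier A\<rbrakk>
          \<Longrightarrow> a \<otimes> scal A c b = scal A c (a \<otimes> b)"
    and star_closed: "a \<in> carrier A \<Longrightarrow> star A a \<in> carrier A"
    and star_star: "a \<in> carrier A \<Longrightarrow> star A (star A a) = a"
    and star_add: "\<lbrakk>a \<in> carrier A; b \<in> carrier A\<rbrakk>
          \<Longrightarrow> star A (a \<oplus> b) = star A a \<oplus> star A b"
    and star_scal: "a \<in> carrier A \<Longrightarrow> star A (scal A c a) = scal A (cnj c) (star A a)"
    and star_mult: "\<lbrakk>a \<in> carrier A; b \<in> carrier A\<rbrakk>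
          \<Longrightarrow> star A (a \<otimes> b) = star A b \<otimes> star A a"
    and cnorm_eq_zero: "a \<in> carrier A \<Longrightarrow> cnorm A a = 0 \<longleftrightarrow> a = \<zero>"
    and cnorm_triangle: "\<lbrakk>a \<in> carrier A; b \<in> carrier A\<rbrakk>
          \<Longrightarrow> cnorm A (a \<oplus> b) \<le> cnorm A a + cnorm A b"
    and cnorm_scal: "a \<in> carrier A \<Longrightarrow> cnorm A (scal A c a) = cmod c * cnorm A a"
    and cnorm_mult: "\<lbrakk>a \<in> carrier A; b \<in> carrier A\<rbrakk>
          \<Longrightarrow> cnorm A (a \<otimes> b) \<le> cnorm A a * cnorm A b"
    and cstar_identity: "a \<in> carrier A \<Longrightarrow> cnorm A (star A a \<otimes> a) = (cnorm A a)\<^sup>2"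
    and cnorm_complete: "\<lbrakk>\<And>k. X k \<in> carrier A;
           \<forall>e>0. \<exists>N. \<forall>k\<ge>N. \<forall>l\<ge>N. cnorm A (X k \<ominus> X l) < e\<rbrakk>
          \<Longrightarrow> \<exists>a\<in>carrier A. (\<lambda>k::nat. cnorm A (X k \<ominus> a)) \<longlonglongrightarrow> 0"

text \<open>\<open>subring\<close> already makes \<open>S\<close> contain the unit of \<open>A\<close>.\<close>

definition unital_cstar_subalgebra :: "'a set \<Rightarrow> ('a, 'z) cstar_scheme \<Rightarrow> bool" where
  "unital_cstar_subalgebra S A \<longleftrightarrow>
     subring S A \<and>
     (\<forall>c. \<forall>a\<in>S. scal A c a \<in> S) \<and>
     (\<forall>a\<in>S. star A a \<in> S) \<and>
     (\<forall>X. \<forall>a\<in>carrier A.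
        (\<forall>k. X k \<in> S) \<and> (\<lambda>k::nat. cnorm A (X k \<ominus>\<^bsub>A\<^esub> a)) \<longlonglongrightarrow> 0 \<longrightarrow> a \<in> S)"

text \<open>Star-homomorphisms, not necessarily unital.\<close>

definition star_hom :: "('a, 'y) cstar_scheme \<Rightarrow> ('b, 'z) cstar_scheme \<Rightarrow> ('a \<Rightarrow> 'b) set" where
  "star_hom A B =
     {f \<in> hom A B \<inter> hom (add_monoid A) (add_monoid B).
        (\<forall>c. \<forall>a\<in>carrier A. f (scal A c a) = scal B c (f a)) \<and>
        (\<forall>a\<in>carrier A. f (star A a) = star B (f a))}"


section \<open>The Toeplitz algebra\<close>

definition toeplitz_relations :: "('a, 'z) cstar_scheme \<Rightarrow> nat \<Rightarrow> (nat \<Rightarrow> 'a) \<Rightarrow> bool" where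
  "toeplitz_relations B n w \<longleftrightarrow>
     (\<forall>i\<in>{1..n}. w i \<in> carrier B) \<and>
     (\<forall>i\<in>{1..n}. \<forall>j\<in>{1..n}.
        star B (w i) \<otimes>\<^bsub>B\<^esub> w j = (if i = j then \<one>\<^bsub>B\<^esub> else \<zero>\<^bsub>B\<^esub>))"

text \<open>\<open>(E, v)\<close> is a universal unital \<open>C\<^sup>*\<close>-algebra generated by \<open>v 1, \<dots>, v n\<close> subject to
  the Toeplitz relations. The homomorphism in the universal property is unique because the
  \<open>v i\<close> generate. Test algebras \<open>B\<close> have their carrier inside the type \<open>real\<close>, which
  loses no generality: only the \<open>C\<^sup>*\<close>-algebra generated by \<open>w 1, \<dots>, w n\<close> matters, and that
  one is separable, hence of cardinality at most the continuum, hence isomorphic to a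
  \<open>C\<^sup>*\<close>-algebra whose carrier is a set of reals.\<close>

definition is_toeplitz_algebra :: "nat \<Rightarrow> 'e cstar \<Rightarrow> (nat \<Rightarrow> 'e) \<Rightarrow> bool" where
  "is_toeplitz_algebra n E v \<longleftrightarrow>
     unital_cstar_algebra E \<and>
     toeplitz_relations E n v \<and>
     (\<forall>S. unital_cstar_subalgebra S E \<and> v ` {1..n} \<subseteq> S \<longrightarrow> S = carrier E) \<and>
     (\<forall>(B :: real cstar) w. unital_cstar_algebra B \<and> toeplitz_relations B n w \<longrightarrow>
        (\<exists>f \<in> star_hom E B. f \<one>\<^bsub>E\<^esub> = \<one>\<^bsub>B\<^esub> \<and> (\<forall>i\<in>{1..n}. f (v i) = w i)))"


section \<open>Operators on a Hilbert space\<close>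

text \<open>Elements of \<open>'h \<Rightarrow>\<^sub>L 'h\<close> are only real linear; \<open>bounded_ops\<close> selects the complex
  linear ones. The adjoint exists, and is unique, by the Riesz theorem.\<close>

definition op_scaleC :: "complex \<Rightarrow> ('h::complex_hilbert \<Rightarrow>\<^sub>L 'h) \<Rightarrow> ('h \<Rightarrow>\<^sub>L 'h)" where
  "op_scaleC c T = Blinfun (\<lambda>x. c *\<^sub>C T x)"

definition op_adj :: "('h::complex_hilbert \<Rightarrow>\<^sub>L 'h) \<Rightarrow> ('h \<Rightarrow>\<^sub>L 'h)" where
  "op_adj T = (THE S :: 'h \<Rightarrow>\<^sub>L 'h. \<forall>x y. cinner (T x) y = cinner x (S y))"

definition bounded_ops :: "('h::complex_hilbert \<Rightarrow>\<^sub>L 'h) cstar" where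
  "bounded_ops =
     \<lparr>carrier = {T :: 'h \<Rightarrow>\<^sub>L 'h. \<forall>c x. T (c *\<^sub>C x) = c *\<^sub>C T x},
      mult = (o\<^sub>L), one = id_blinfun, zero = 0, add = (+),
      scal = op_scaleC, star = op_adj, cnorm = norm\<rparr>"

definition op_alg :: "('h::complex_hilbert \<Rightarrow>\<^sub>L 'h) set \<Rightarrow> ('h \<Rightarrow>\<^sub>L 'h) cstar" where
  "op_alg A = bounded_ops\<lparr>carrier := A\<rparr>"

definition commutant :: "('h::complex_hilbert \<Rightarrow>\<^sub>L 'h) set \<Rightarrow> ('h \<Rightarrow>\<^sub>L 'h) set" where
  "commutant A = {T \<in> carrier bounded_ops. \<forall>S\<in>A. T o\<^sub>L S = S o\<^sub>L T}"

text \<open>The real span below is a complex subspace, since the range of \<open>\<omega>\<close> is closed under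
  complex scalars.\<close>

definition nondegenerate_rep ::
    "('e, 'z) cstar_scheme \<Rightarrow> ('e \<Rightarrow> ('h::complex_hilbert \<Rightarrow>\<^sub>L 'h)) \<Rightarrow> bool" where
  "nondegenerate_rep E \<omega> \<longleftrightarrow>
     \<omega> \<in> star_hom E bounded_ops \<and>
     closure (span {\<omega> a x | a x. a \<in> carrier E}) = UNIV"


section \<open>Hilbert modules and Invariant Basis Number\<close>

text \<open>The data of a right Hilbert module over \<open>D\<close> that enter the definition of adjointable
  operators.\<close>

record ('x, 'd) hilbert_module = "'x partial_object" +
  madd :: "'x \<Rightarrow> 'x \<Rightarrow> 'x"
  ract :: "'x \<Rightarrow> 'd \<Rightarrow> 'x"
  ip :: "'x \<Rightarrow> 'x \<Rightarrow> 'd"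

definition module_hom ::
    "('d, 'z) cstar_scheme \<Rightarrow> ('x, 'd) hilbert_module \<Rightarrow> ('y, 'd) hilbert_module \<Rightarrow> ('x \<Rightarrow> 'y) set"
  where "module_hom D X Y =
     {T \<in> carrier X \<rightarrow> carrier Y.
        (\<forall>x\<in>carrier X. \<forall>x'\<in>carrier X. T (madd X x x') = madd Y (T x) (T x')) \<and>
        (\<forall>x\<in>carrier X. \<forall>d\<in>carrier D. T (ract X x d) = ract Y (T x) d)}"

definition is_adjoint ::
    "('x, 'd) hilbert_module \<Rightarrow> ('y, 'd) hilbert_module \<Rightarrow> ('x \<Rightarrow> 'y) \<Rightarrow> ('y \<Rightarrow> 'x) \<Rightarrow> bool"
  where "is_adjoint X Y T S \<longleftrightarrow>
     S \<in> carrier Y \<rightarrow> carrier X \<and>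
     (\<forall>x\<in>carrier X. \<forall>y\<in>carrier Y. ip Y (T x) y = ip X x (S y))"

definition adjointable ::
    "('d, 'z) cstar_scheme \<Rightarrow> ('x, 'd) hilbert_module \<Rightarrow> ('y, 'd) hilbert_module \<Rightarrow> ('x \<Rightarrow> 'y) set"
  where "adjointable D X Y = {T \<in> module_hom D X Y. \<exists>S. is_adjoint X Y T S}"

definition unitary_maps ::
    "('d, 'z) cstar_scheme \<Rightarrow> ('x, 'd) hilbert_module \<Rightarrow> ('y, 'd) hilbert_module \<Rightarrow> ('x \<Rightarrow> 'y) set"
  where "unitary_maps D X Y =
     {U \<in> adjointable D X Y. \<exists>S. is_adjoint X Y U S \<and>
        (\<forall>x\<in>carrier X. S (U x) = x) \<and> (\<forall>y\<in>carrier Y. U (S y) = y)}"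

definition free_module :: "('d, 'z) cstar_scheme \<Rightarrow> nat \<Rightarrow> (nat \<Rightarrow> 'd, 'd) hilbert_module" where
  "free_module D n =
     \<lparr>carrier = {1..n} \<rightarrow>\<^sub>E carrier D,
      madd = (\<lambda>x y. \<lambda>i\<in>{1..n}. x i \<oplus>\<^bsub>D\<^esub> y i),
      ract = (\<lambda>x d. \<lambda>i\<in>{1..n}. x i \<otimes>\<^bsub>D\<^esub> d),
      ip = (\<lambda>x y. \<Oplus>\<^bsub>D\<^esub>i\<in>{1..n}. star D (x i) \<otimes>\<^bsub>D\<^esub> y i)\<rparr>"

definition std_basis :: "('d, 'z) cstar_scheme \<Rightarrow> nat \<Rightarrow> nat \<Rightarrow> (nat \<Rightarrow> 'd)" where
  "std_basis D n i = (\<lambda>j\<in>{1..n}. if j = i then \<one>\<^bsub>D\<^esub> else \<zero>\<^bsub>D\<^esub>)"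

definition IBN :: "('d, 'z) cstar_scheme \<Rightarrow> bool" where
  "IBN D \<longleftrightarrow>
     (\<forall>n\<ge>1. \<forall>m\<ge>1. unitary_maps D (free_module D n) (free_module D m) \<noteq> {} \<longleftrightarrow> n = m)"


section \<open>Free equivalence\<close>

text \<open>In the next three definitions \<open>v\<close> is the family of Toeplitz generators.\<close>

definition rep_endo ::
    "nat \<Rightarrow> (nat \<Rightarrow> 'e) \<Rightarrow> ('e \<Rightarrow> ('h::complex_hilbert \<Rightarrow>\<^sub>L 'h)) \<Rightarrow> ('h \<Rightarrow>\<^sub>L 'h) \<Rightarrow> ('h \<Rightarrow>\<^sub>L 'h)"
  where "rep_endo n v \<omega> a = (\<Sum>i=1..n. \<omega> (v i) o\<^sub>L a o\<^sub>L op_adj (\<omega> (v i)))"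

definition rep_sigma ::
    "('h::complex_hilbert \<Rightarrow>\<^sub>L 'h) cstar \<Rightarrow> nat \<Rightarrow> (nat \<Rightarrow> 'e) \<Rightarrow> ('e \<Rightarrow> ('h \<Rightarrow>\<^sub>L 'h)) \<Rightarrow>
      (nat \<Rightarrow> ('h \<Rightarrow>\<^sub>L 'h)) \<Rightarrow> ('h \<Rightarrow>\<^sub>L 'h)"
  where "rep_sigma D n v \<omega> x =
     (\<Sum>i=1..n. \<omega> (v i) o\<^sub>L ip (free_module D n) (std_basis D n i) x)"

definition free_equivalent ::
    "('h::complex_hilbert \<Rightarrow>\<^sub>L 'h) cstar \<Rightarrow> nat \<Rightarrow> (nat \<Rightarrow> 'e) \<Rightarrow>
      ('e \<Rightarrow> ('h \<Rightarrow>\<^sub>L 'h)) \<Rightarrow> ('e \<Rightarrow> ('h \<Rightarrow>\<^sub>L 'h)) \<Rightarrow> bool"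
  where "free_equivalent D n v \<omega> \<tau> \<longleftrightarrow>
     (\<exists>U \<in> unitary_maps D (free_module D n) (free_module D n).
        \<forall>x \<in> carrier (free_module D n). rep_sigma D n v \<omega> x = rep_sigma D n v \<tau> (U x))"

end

theory Submission
  imports Defs
begin

text \<open>Write \<open>V\<^sub>i\<close> and \<open>W\<^sub>j\<close> for the images of the generators under \<open>\<omega>\<close> and \<open>\<tau>\<close>. The relations
  \<open>\<alpha>(a) V\<^sub>j = V\<^sub>j a\<close> and \<open>W\<^sub>i\<^sup>* \<beta>(a) = a W\<^sub>i\<^sup>*\<close> show that \<open>\<alpha> = \<beta>\<close> puts \<open>u\<^sub>i\<^sub>j = W\<^sub>i\<^sup>* V\<^sub>j\<close> into the
  commutant; since \<open>\<alpha>(1) = \<beta>(1)\<close> is the common range projection of both families, \<open>u\<close> is a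
  unitary matrix with \<open>V\<^sub>j = \<Sum>\<^sub>i W\<^sub>i u\<^sub>i\<^sub>j\<close>, and IBN forces it to be square. Conversely, a module
  unitary is given by such a matrix, and \<open>u u\<^sup>* = 1\<close> together with \<open>u\<^sub>i\<^sub>j a = a u\<^sub>i\<^sub>j\<close> turns
  \<open>\<Sum>\<^sub>j V\<^sub>j a V\<^sub>j\<^sup>*\<close> into \<open>\<Sum>\<^sub>i W\<^sub>i a W\<^sub>i\<^sup>*\<close>.\<close>

section \<open>Adjoints of bounded operators\<close>

lemma cinner_add_left: "cinner (x + y) z = cinner x z + cinner y (z :: 'h::complex_hilbert)"
  by (metis cinner_add_right cinner_commute complex_cnj_add)

lemma cinner_scaleC_left: "cinner (c *\<^sub>C x) (y :: 'h::complex_hilbert) = cnj c * cinner x y"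
  by (metis cinner_commute cinner_scaleC_right complex_cnj_mult)

lemma Re_cinner_commute: "Re (cinner x y) = Re (cinner y (x :: 'h::complex_hilbert))"
  by (metis cinner_commute cnj.simps(1))

lemma Re_cinner_self: "Re (cinner x x) = (norm (x :: 'h::complex_hilbert))\<^sup>2"
  unfolding cinner_self by (rule Re_complex_of_real)

lemma norm_add_power2:
  "(norm (x + y))\<^sup>2 = (norm x)\<^sup>2 + 2 * Re (cinner x y) + (norm (y :: 'h::complex_hilbert))\<^sup>2"
  using Re_cinner_commute[of y x]
  by (simp add: cinner_add_left cinner_add_right Re_cinner_self flip: Re_cinner_self[of "x + y"])

lemma Re_cinner_scaleR_right: "Re (cinner x (r *\<^sub>R y)) = r * Re (cinner x (y :: 'h::complex_hilbert))"
  by (simp flip: scaleC_of_real add: cinner_scaleC_right)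

lemma Re_cinner_scaleR_left: "Re (cinner (r *\<^sub>R x) y) = r * Re (cinner x (y :: 'h::complex_hilbert))"
  by (metis Re_cinner_commute Re_cinner_scaleR_right)

text \<open>Cauchy-Schwarz for the real part. The norm already satisfies the triangle inequality, so
  squaring that inequality and cancelling the two squares suffices.\<close>

lemma Re_cinner_le: "Re (cinner x y) \<le> norm x * norm (y :: 'h::complex_hilbert)"
proof -
  have "(norm (x + y))\<^sup>2 \<le> (norm x + norm y)\<^sup>2"
    by (simp add: norm_triangle_ineq power_mono)
  then show ?thesis
    by (simp add: norm_add_power2 power2_sum)
qed

lemma abs_Re_cinner_le: "\<bar>Re (cinner x y)\<bar> \<le> norm x * norm (y :: 'h::complex_hilbert)"
  using Re_cinner_le[of x y] Re_cinner_le[of x "-1 *\<^sub>R y"]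
  unfolding Re_cinner_scaleR_right by simp

text \<open>Gives access to the library of real bounded bilinear maps. The class
  \<open>complex_hilbert\<close> extends only the real Banach spaces, so the analysis is done with
  this real form.\<close>

lemma bounded_bilinear_Re_cinner:
  "bounded_bilinear (\<lambda>x y. Re (cinner x (y :: 'h::complex_hilbert)))"
  by (rule bounded_bilinear.intro)
    (auto simp: cinner_add_left cinner_add_right Re_cinner_scaleR_left Re_cinner_scaleR_right
      intro!: exI[of _ 1] abs_Re_cinner_le)

text \<open>Replacing \<open>x\<close> by \<open>\<i> *\<^sub>C x\<close> turns the real part into
  the imaginary part, by complex linearity of \<open>T\<close>. Hence a Riesz theorem for real
  functionals is enough.\<close>

lemma cinner_eqI_Re:
  fixes T S :: "'h::complex_hilbert \<Rightarrow> 'h"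
  assumes "\<And>x. Re (cinner (T x) y) = Re (cinner x z)"
    and "\<And>c x. T (c *\<^sub>C x) = c *\<^sub>C T x"
  shows "cinner (T x) y = cinner x z"
proof (rule complex_eqI)
  show "Re (cinner (T x) y) = Re (cinner x z)" by (rule assms)
  have "Re (cinner (T (\<i> *\<^sub>C x)) y) = Re (cinner (\<i> *\<^sub>C x) z)" by (rule assms)
  then show "Im (cinner (T x) y) = Im (cinner x z)"
    by (simp add: assms(2) cinner_scaleC_left)
qed

lemma cinner_ext:
  assumes "\<And>x. Re (cinner x y) = Re (cinner x (z :: 'h::complex_hilbert))"
  shows "y = z"
proof -
  interpret b: bounded_bilinear "\<lambda>x y. Re (cinner x (y :: 'h))"
    by (rule bounded_bilinear_Re_cinner)
  have "Re (cinner (y - z) (y - z)) = 0"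
    using assms by (simp add: b.diff_right)
  then show ?thesis by (simp add: Re_cinner_self)
qed

text \<open>The representing vector minimises
  \<open>\<parallel>x\<parallel>\<^sup>2 - 2 g x\<close>, and minimising sequences are Cauchy by the parallelogram identity.\<close>

lemma riesz_real:
  fixes g :: "'h::complex_hilbert \<Rightarrow> real"
  assumes "bounded_linear g"
  shows "\<exists>z. \<forall>x. g x = Re (cinner x z)"
proof -
  interpret g: bounded_linear g by fact
  interpret b: bounded_bilinear "\<lambda>x y. Re (cinner x (y :: 'h))"
    by (rule bounded_bilinear_Re_cinner)
  define J where "J x = (norm x)\<^sup>2 - 2 * g x" for x
  obtain K where K: "\<And>x. norm (g x) \<le> norm x * K"
    using g.bounded by blast
  \<comment> \<open>Completing the square in \<open>norm x\<close> bounds \<open>J\<close> from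
    below, so its infimum \<open>d\<close> exists.\<close>
  have low: "J x \<ge> - K\<^sup>2" for x
  proof -
    have "g x \<le> norm x * K" using K[of x] by simp
    moreover have "0 \<le> (norm x - K)\<^sup>2" by simp
    ultimately show ?thesis by (simp add: J_def power2_diff)
  qed
  define d where "d = Inf (range J)"
  have bdd: "bdd_below (range J)" using low by (auto intro!: bdd_belowI)
  have d_le: "d \<le> J x" for x
    unfolding d_def by (rule cInf_lower) (auto simp: bdd)
  have "\<exists>x. J x < d + 1 / real (Suc k)" for k
    using cInf_lessD[of "range J" "d + 1 / real (Suc k)"] by (auto simp: d_def)
  then obtain X where X: "\<And>k. J (X k) < d + 1 / real (Suc k)" by metis
  \<comment> \<open>The parallelogram identity; the terms in \<open>g\<close> cancel because
    \<open>g\<close> is additive.\<close>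
  have par: "(norm (x - y))\<^sup>2 = 2 * J x + 2 * J y - 4 * J ((1/2) *\<^sub>R (x + y))" for x y
  proof -
    have "norm ((1/2) *\<^sub>R (x + y)) = norm (x + y) / 2"
      unfolding norm_scaleR by simp
    then have "J ((1/2) *\<^sub>R (x + y)) = (norm (x + y))\<^sup>2 / 4 - (g x + g y)"
      unfolding J_def by (simp add: g.add g.scaleR power_divide add_divide_distrib del: scaleR_add_right)
    then show ?thesis
      using norm_add_power2[of x y] norm_add_power2[of x "-y"] J_def[of x] J_def[of y]
      unfolding b.minus_right norm_minus_cancel add_uminus_conv_diff by linarith
  qed
  \<comment> \<open>At the midpoint \<open>J\<close> is at least \<open>d\<close>, while
    \<open>J (X k)\<close> and \<open>J (X l)\<close> exceed \<open>d\<close> by at most the chosen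
    errors.\<close>
  have dist: "(norm (X k - X l))\<^sup>2 \<le> 2 / real (Suc k) + 2 / real (Suc l)" for k l
    using X[of k] X[of l] d_le[of "(1/2) *\<^sub>R (X k + X l)"] unfolding par by simp
  have "Cauchy X"
  proof (rule metric_CauchyI)
    fix e :: real assume "e > 0"
    then obtain N where N: "real N > 4 / e\<^sup>2" using reals_Archimedean2 by blast
    have "0 < 4 / e\<^sup>2" using \<open>e > 0\<close> by simp
    then have N0: "real N > 0" using N by linarith
    have N4: "4 / real N < e\<^sup>2" using N N0 \<open>e > 0\<close> by (simp add: field_simps)
    have "dist (X k) (X l) < e" if "k \<ge> N" "l \<ge> N" for k l
    proof -
      have "2 / real (Suc k) \<le> 2 / real N" "2 / real (Suc l) \<le> 2 / real N"
        using that N0 by (auto intro!: divide_left_mono)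
      then have "(norm (X k - X l))\<^sup>2 < e\<^sup>2" using dist[of k l] N4 by simp
      then show ?thesis using \<open>e > 0\<close> by (simp add: dist_norm power2_less_imp_less)
    qed
    then show "\<exists>M. \<forall>k\<ge>M. \<forall>l\<ge>M. dist (X k) (X l) < e" by blast
  qed
  then obtain z where z: "X \<longlonglongrightarrow> z" using Cauchy_convergent convergentD by blast
  have "(\<lambda>k. J (X k)) \<longlonglongrightarrow> J z"
    unfolding J_def by (intro tendsto_intros z g.tendsto)
  moreover have "(\<lambda>k. d + 1 / real (Suc k)) \<longlonglongrightarrow> d + 0"
    by (intro tendsto_intros lim_inverse_n'[THEN LIMSEQ_Suc])
  ultimately have "J z \<le> d + 0"
    by (rule LIMSEQ_le) (use X less_imp_le in blast)
  then have min: "J z \<le> J x" for x using d_le[of x] by linarith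
  \<comment> \<open>First variation: along the line \<open>z + t *\<^sub>R x\<close> the increment
    of \<open>J\<close> is a quadratic in \<open>t\<close> with linear coefficient
    \<open>2 * c\<close>, and it is nonnegative only if \<open>c = 0\<close>.\<close>
  have "g x = Re (cinner x z)" for x
  proof -
    define c where "c = Re (cinner z x) - g x"
    define q where "q = (norm x)\<^sup>2"
    have quad: "0 \<le> t\<^sup>2 * q + 2 * t * c" for t
      using min[of "z + t *\<^sub>R x"] norm_add_power2[of z "t *\<^sub>R x"]
      by (simp add: J_def g.add g.scaleR Re_cinner_scaleR_right c_def q_def power_mult_distrib
          algebra_simps)
    have "q \<ge> 0" by (simp add: q_def)
    have "c = 0"
    proof (rule ccontr)
      assume "c \<noteq> 0"
      \<comment> \<open>The minimum over \<open>t\<close> lies at \<open>- c / q\<close>; the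
        denominator \<open>q + 1\<close> stays positive also for \<open>x = 0\<close> and still
        gives a negative value.\<close>
      define s where "s = c / (q + 1)"
      have "c = s * (q + 1)" using \<open>q \<ge> 0\<close> by (simp add: s_def)
      then have "s\<^sup>2 * q + 2 * - s * c = - (s\<^sup>2 * (q + 2))"
        by (simp add: power2_eq_square algebra_simps)
      moreover have "s\<^sup>2 * (q + 2) > 0" using \<open>c \<noteq> 0\<close> \<open>q \<ge> 0\<close> by (simp add: s_def)
      ultimately show False using quad[of "- s"] by simp
    qed
    then show ?thesis by (simp add: c_def Re_cinner_commute)
  qed
  then show ?thesis by blast
qed

section \<open>Existence, uniqueness and algebra of adjoints\<close>

definition clinear_op :: "('h::complex_hilbert \<Rightarrow>\<^sub>L 'h) \<Rightarrow> bool" where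
  "clinear_op T \<longleftrightarrow> (\<forall>c x. T (c *\<^sub>C x) = c *\<^sub>C T x)"

text \<open>For each \<open>y\<close>, Riesz represents the functional
  \<open>x \<mapsto> Re (cinner (T x) y)\<close> by a vector \<open>s y\<close>. Uniqueness of that
  vector makes \<open>s\<close> linear, and \<open>cinner_eqI_Re\<close> recovers the complex
  identity.\<close>

lemma adjoint_ex:
  fixes T :: "'h::complex_hilbert \<Rightarrow>\<^sub>L 'h"
  assumes "clinear_op T"
  shows "\<exists>S :: 'h \<Rightarrow>\<^sub>L 'h. \<forall>x y. cinner (T x) y = cinner x (S y)"
proof -
  interpret b: bounded_bilinear "\<lambda>x y. Re (cinner x (y :: 'h))"
    by (rule bounded_bilinear_Re_cinner)
  have "\<exists>z. \<forall>x. Re (cinner (T x) y) = Re (cinner x z)" for y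
    by (rule riesz_real)
      (rule bounded_linear_compose[OF b.bounded_linear_left blinfun.bounded_linear_right])
  then obtain s where s: "\<And>x y. Re (cinner (T x) y) = Re (cinner x (s y))" by metis
  have "bounded_linear s"
  proof (rule bounded_linear_intro)
    show "s (x + y) = s x + s y" for x y
      by (rule cinner_ext) (simp add: b.add_right flip: s)
    show "s (r *\<^sub>R x) = r *\<^sub>R s x" for r x
      by (rule cinner_ext) (simp add: b.scaleR_right flip: s)
    \<comment> \<open>Testing the defining identity on \<open>s y\<close> itself bounds its squared
      norm; one factor \<open>norm (s y)\<close> is then cancelled.\<close>
    show "norm (s y) \<le> norm y * norm T" for y
    proof -
      have "(norm (s y))\<^sup>2 = Re (cinner (s y) (s y))" by (simp add: Re_cinner_self)
      also have "\<dots> = Re (cinner (T (s y)) y)" by (simp add: s)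
      also have "\<dots> \<le> norm (T (s y)) * norm y" by (rule Re_cinner_le)
      also have "\<dots> \<le> norm T * norm (s y) * norm y"
        by (intro mult_right_mono norm_blinfun) auto
      finally have "norm (s y) * norm (s y) \<le> norm (s y) * (norm y * norm T)"
        by (simp add: power2_eq_square mult_ac)
      then show ?thesis
        by (cases "norm (s y) = 0") (auto simp: mult_le_cancel_left)
    qed
  qed
  then have "\<forall>x y. cinner (T x) y = cinner x (Blinfun s y)"
    using cinner_eqI_Re[of T _ "s _"] s assms
    by (simp add: bounded_linear_Blinfun_apply clinear_op_def)
  then show ?thesis by blast
qed

text \<open>Resolves the definite description: two candidates have the same inner products with
  every vector. The rules for adjoints of products, sums and double adjoints all rest on it.\<close>

lemma op_adj_eqI:
  fixes T S :: "'h::complex_hilbert \<Rightarrow>\<^sub>L 'h"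
  assumes "\<And>x y. cinner (T x) y = cinner x (S y)"
  shows "op_adj T = S"
  unfolding op_adj_def
proof (rule the_equality)
  show "R = S" if "\<forall>x y. cinner (T x) y = cinner x (R y)" for R :: "'h \<Rightarrow>\<^sub>L 'h"
    by (rule blinfun_eqI, rule cinner_ext) (metis that assms)
qed (use assms in blast)

lemma cinner_op_adj:
  assumes "clinear_op T"
  shows "cinner (T x) y = cinner x (op_adj T y)"
proof -
  obtain S :: "'a \<Rightarrow>\<^sub>L 'a" where S: "\<And>x y. cinner (T x) y = cinner x (S y)"
    using adjoint_ex[OF assms] by blast
  then show ?thesis using op_adj_eqI[OF S] by simp
qed

lemma cinner_op_adj':
  assumes "clinear_op T"
  shows "cinner (op_adj T x) y = cinner x (T y)"
  by (metis assms cinner_commute cinner_op_adj)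

lemma clinear_op_adj:
  assumes "clinear_op T"
  shows "clinear_op (op_adj T)"
  unfolding clinear_op_def
  by (intro allI cinner_ext) (simp add: cinner_scaleC_right flip: cinner_op_adj[OF assms])

lemma op_adj_adj: "clinear_op T \<Longrightarrow> op_adj (op_adj T) = T"
  by (rule op_adj_eqI) (rule cinner_op_adj')

lemma clinear_op_compose: "clinear_op T \<Longrightarrow> clinear_op S \<Longrightarrow> clinear_op (T o\<^sub>L S)"
  by (simp add: clinear_op_def)

lemma clinear_op_add: "clinear_op T \<Longrightarrow> clinear_op S \<Longrightarrow> clinear_op (T + S)"
  by (simp add: clinear_op_def blinfun.add_left scaleC_add_right)

lemma clinear_op_0: "clinear_op (0 :: 'h::complex_hilbert \<Rightarrow>\<^sub>L 'h)"
  by (metis add_0 add_cancel_right_right blinfun.zero_left clinear_op_def scaleC_add_right)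

lemma clinear_op_id: "clinear_op id_blinfun"
  by (simp add: clinear_op_def)

lemma op_adj_compose:
  "clinear_op T \<Longrightarrow> clinear_op S \<Longrightarrow> op_adj (T o\<^sub>L S) = op_adj S o\<^sub>L op_adj T"
  by (rule op_adj_eqI) (simp add: cinner_op_adj)

lemma op_adj_add:
  "clinear_op T \<Longrightarrow> clinear_op S \<Longrightarrow> op_adj (T + S) = op_adj T + op_adj S"
  by (rule op_adj_eqI) (simp add: cinner_op_adj blinfun.add_left cinner_add_left cinner_add_right)

lemma op_adj_0: "op_adj (0 :: 'h::complex_hilbert \<Rightarrow>\<^sub>L 'h) = 0"
  using op_adj_add[OF clinear_op_0 clinear_op_0] by simp

lemma op_adj_id: "op_adj id_blinfun = id_blinfun"
  by (rule op_adj_eqI) simp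

text \<open>Both claims are proved together, since taking the adjoint of a partial sum in the
  induction requires its complex linearity.\<close>

lemma op_adj_sum:
  assumes "\<And>i. i \<in> I \<Longrightarrow> clinear_op (f i)"
  shows "clinear_op (sum f I) \<and> op_adj (sum f I) = (\<Sum>i\<in>I. op_adj (f i))"
  using assms
  by (induction I rule: infinite_finite_induct)
    (auto simp: clinear_op_0 op_adj_0 clinear_op_add op_adj_add)

section \<open>Commutants\<close>

lemma blinfun_compose_assoc: "(f o\<^sub>L g) o\<^sub>L h = f o\<^sub>L (g o\<^sub>L h)"
  by (rule blinfun_eqI) simp

lemma blinfun_compose_id: "f o\<^sub>L id_blinfun = f" "id_blinfun o\<^sub>L f = f"
  by (auto intro: blinfun_eqI)

text \<open>The Toeplitz and unitarity relations produce Kronecker deltas; this form and the next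
  let sums over them collapse.\<close>

lemma compose_delta_left: "(if b then id_blinfun else 0) o\<^sub>L T = (if b then T else 0)"
  by (simp add: blinfun_compose_id)

lemma compose_delta_right: "T o\<^sub>L (if b then id_blinfun else 0) = (if b then T else 0)"
  by (simp add: blinfun_compose_id)

lemma blinfun_compose_sum_left: "sum f I o\<^sub>L g = (\<Sum>i\<in>I. f i o\<^sub>L g)"
  by (rule bounded_bilinear.sum_left[OF bounded_bilinear_blinfun_compose])

lemma blinfun_compose_sum_right: "g o\<^sub>L sum f I = (\<Sum>i\<in>I. g o\<^sub>L f i)"
  by (rule bounded_bilinear.sum_right[OF bounded_bilinear_blinfun_compose])

lemma carrier_bounded_ops: "carrier bounded_ops = Collect clinear_op"
  by (auto simp: bounded_ops_def clinear_op_def)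

lemma mem_commutant: "T \<in> commutant A \<longleftrightarrow> clinear_op T \<and> (\<forall>S\<in>A. T o\<^sub>L S = S o\<^sub>L T)"
  by (simp add: commutant_def carrier_bounded_ops)

lemma commutant_clinear: "T \<in> commutant A \<Longrightarrow> clinear_op T"
  by (simp add: mem_commutant)

lemma commutant_0: "0 \<in> commutant A"
  by (simp add: mem_commutant clinear_op_0)

lemma commutant_id: "id_blinfun \<in> commutant A"
  by (auto simp: mem_commutant clinear_op_id intro: blinfun_eqI)

lemma commutant_add: "T \<in> commutant A \<Longrightarrow> S \<in> commutant A \<Longrightarrow> T + S \<in> commutant A"
  by (simp add: mem_commutant clinear_op_add bounded_bilinear.add_left[OF bounded_bilinear_blinfun_compose]
      bounded_bilinear.add_right[OF bounded_bilinear_blinfun_compose])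

lemma commutant_compose:
  assumes "T \<in> commutant A" "S \<in> commutant A" shows "T o\<^sub>L S \<in> commutant A"
  using assms unfolding mem_commutant
  by (metis blinfun_compose_assoc clinear_op_compose)

lemma commutant_adj:
  assumes "T \<in> commutant A" and "\<And>S. S \<in> A \<Longrightarrow> op_adj S \<in> A" and "\<And>S. S \<in> A \<Longrightarrow> clinear_op S"
  shows "op_adj T \<in> commutant A"
  unfolding mem_commutant
proof (intro conjI ballI)
  have T: "clinear_op T" using assms(1) by (rule commutant_clinear)
  then show "clinear_op (op_adj T)" by (rule clinear_op_adj)
  fix S assume "S \<in> A"
  \<comment> \<open>\<open>T\<close> commutes with the adjoint of \<open>S\<close>, which lies in
    \<open>A\<close>; taking adjoints of that relation gives the claim for \<open>S\<close>.\<close>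
  then have "op_adj (T o\<^sub>L op_adj S) = op_adj (op_adj S o\<^sub>L T)"
    using assms by (simp add: mem_commutant)
  then show "op_adj T o\<^sub>L S = S o\<^sub>L op_adj T"
    using \<open>S \<in> A\<close> T assms(3) by (simp add: op_adj_compose op_adj_adj clinear_op_adj)
qed

lemma commutant_sum: "(\<And>i. i \<in> I \<Longrightarrow> f i \<in> commutant A) \<Longrightarrow> sum f I \<in> commutant A"
  by (induction I rule: infinite_finite_induct) (auto simp: commutant_0 commutant_add)

section \<open>The commutant as a ring record\<close>

lemma op_alg_simps:
  "carrier (op_alg A) = A" "mult (op_alg A) = (o\<^sub>L)" "one (op_alg A) = id_blinfun"
  "zero (op_alg A) = 0" "add (op_alg A) = (+)" "star (op_alg A) = op_adj"
  by (simp_all add: op_alg_def bounded_ops_def)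

lemma abelian_monoid_commutant: "abelian_monoid (op_alg (commutant A))"
  by (rule abelian_monoidI) (auto simp: op_alg_simps commutant_0 commutant_add)

text \<open>The inner product of \<open>free_module\<close> is a sum in the record; this converts it
  to the sum of the operator type. Both sums are \<open>0\<close> on infinite index sets.\<close>

lemma finsum_commutant:
  assumes "\<And>i. i \<in> I \<Longrightarrow> f i \<in> commutant A"
  shows "finsum (op_alg (commutant A)) f I = sum f I"
proof -
  interpret abelian_monoid "op_alg (commutant A)" by (rule abelian_monoid_commutant)
  show ?thesis
    using assms
    by (induction I rule: infinite_finite_induct)
      (auto simp: op_alg_simps finsum_infinite finsum_insert Pi_iff)
qed

section \<open>Free modules over a commutant\<close>

text \<open>These two properties make the commutant closed under adjoints, hence a coefficient
  algebra for inner products.\<close>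

locale star_closed_ops =
  fixes A :: "('h::complex_hilbert \<Rightarrow>\<^sub>L 'h) set"
  assumes clinear: "S \<in> A \<Longrightarrow> clinear_op S"
    and adj: "S \<in> A \<Longrightarrow> op_adj S \<in> A"
begin

abbreviation D where "D \<equiv> op_alg (commutant A)"

lemma adj_closed: "T \<in> commutant A \<Longrightarrow> op_adj T \<in> commutant A"
  by (rule commutant_adj[OF _ adj clinear])

lemma carrier_free_module: "carrier (free_module D n) = {1..n} \<rightarrow>\<^sub>E commutant A"
  by (simp add: free_module_def op_alg_simps)

lemma free_module_coord:
  "x \<in> carrier (free_module D n) \<Longrightarrow> i \<in> {1..n} \<Longrightarrow> x i \<in> commutant A"
  by (auto simp: carrier_free_module)

lemma free_module_ip:
  assumes "x \<in> carrier (free_module D n)" "y \<in> carrier (free_module D n)"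
  shows "ip (free_module D n) x y = (\<Sum>i=1..n. op_adj (x i) o\<^sub>L y i)"
proof -
  have "ip (free_module D n) x y = finsum D (\<lambda>i. op_adj (x i) o\<^sub>L y i) {1..n}"
    by (simp add: free_module_def op_alg_simps)
  also have "\<dots> = (\<Sum>i=1..n. op_adj (x i) o\<^sub>L y i)"
    using assms by (intro finsum_commutant commutant_compose adj_closed free_module_coord)
  finally show ?thesis .
qed

lemma std_basis_apply:
  "j \<in> {1..n} \<Longrightarrow> std_basis D n i j = (if j = i then id_blinfun else 0)"
  by (simp add: std_basis_def op_alg_simps)

lemma std_basis_carrier: "std_basis D n i \<in> carrier (free_module D n)"
  by (auto simp: carrier_free_module std_basis_def op_alg_simps commutant_0 commutant_id)

lemma ip_std_basis_left:
  assumes "x \<in> carrier (free_module D n)" "i \<in> {1..n}"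
  shows "ip (free_module D n) (std_basis D n i) x = x i"
proof -
  have "ip (free_module D n) (std_basis D n i) x
      = (\<Sum>j=1..n. op_adj (std_basis D n i j) o\<^sub>L x j)"
    by (rule free_module_ip[OF std_basis_carrier assms(1)])
  also have "\<dots> = (\<Sum>j=1..n. if j = i then x j else 0)"
    by (rule sum.cong) (auto simp: std_basis_apply op_adj_id op_adj_0 intro: blinfun_eqI)
  finally show ?thesis using assms(2) by simp
qed

text \<open>The first slot is conjugate linear, so the coordinate emerges as an adjoint. This is how
  the coordinates of \<open>U x\<close> are later expressed through the adjoint map of
  \<open>U\<close>.\<close>

lemma ip_std_basis_right:
  assumes "x \<in> carrier (free_module D n)" "i \<in> {1..n}"
  shows "ip (free_module D n) x (std_basis D n i) = op_adj (x i)"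
proof -
  have "ip (free_module D n) x (std_basis D n i)
      = (\<Sum>j=1..n. op_adj (x j) o\<^sub>L std_basis D n i j)"
    by (rule free_module_ip[OF assms(1) std_basis_carrier])
  also have "\<dots> = (\<Sum>j=1..n. if j = i then op_adj (x j) else 0)"
    by (rule sum.cong) (auto simp: std_basis_apply intro: blinfun_eqI)
  finally show ?thesis using assms(2) by simp
qed

text \<open>Displays \<open>\<sigma>\<close> as a row of isometries multiplied by a column, so that
  free equivalence becomes a matrix identity.\<close>

lemma rep_sigma_eq:
  "x \<in> carrier (free_module D n) \<Longrightarrow> rep_sigma D n v \<omega> x = (\<Sum>i=1..n. \<omega> (v i) o\<^sub>L x i)"
  unfolding rep_sigma_def by (rule sum.cong) (simp_all add: ip_std_basis_left)

section \<open>Matrices over the commutant acting on columns\<close>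

definition mat_act ::
    "nat \<Rightarrow> nat \<Rightarrow> (nat \<Rightarrow> nat \<Rightarrow> 'h \<Rightarrow>\<^sub>L 'h) \<Rightarrow> (nat \<Rightarrow> 'h \<Rightarrow>\<^sub>L 'h) \<Rightarrow> nat \<Rightarrow> 'h \<Rightarrow>\<^sub>L 'h"
  where "mat_act n m u x = (\<lambda>i\<in>{1..m}. \<Sum>j=1..n. u i j o\<^sub>L x j)"

lemma mat_act_carrier:
  assumes "\<And>i j. i \<in> {1..m} \<Longrightarrow> j \<in> {1..n} \<Longrightarrow> u i j \<in> commutant A"
    and "x \<in> carrier (free_module D n)"
  shows "mat_act n m u x \<in> carrier (free_module D m)"
  unfolding carrier_free_module mat_act_def
  by (intro restrict_PiE_iff[THEN iffD2] ballI commutant_sum commutant_compose assms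
      free_module_coord[OF assms(2)])

lemma mat_act_hom:
  assumes "\<And>i j. i \<in> {1..m} \<Longrightarrow> j \<in> {1..n} \<Longrightarrow> u i j \<in> commutant A"
  shows "mat_act n m u \<in> module_hom D (free_module D n) (free_module D m)"
  unfolding module_hom_def
proof (intro CollectI conjI ballI funcsetI)
  show "mat_act n m u x \<in> carrier (free_module D m)" if "x \<in> carrier (free_module D n)" for x
    using assms that by (rule mat_act_carrier)
  show "mat_act n m u (madd (free_module D n) x y)
      = madd (free_module D m) (mat_act n m u x) (mat_act n m u y)" for x y
    by (auto simp: mat_act_def free_module_def op_alg_simps sum.distrib
        bounded_bilinear.add_right[OF bounded_bilinear_blinfun_compose] intro!: restrict_ext)
  show "mat_act n m u (ract (free_module D n) x d)
      = ract (free_module D m) (mat_act n m u x) d" for x d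
    by (auto simp: mat_act_def free_module_def op_alg_simps blinfun_compose_sum_left
        blinfun_compose_assoc intro!: restrict_ext)
qed

text \<open>Only a one-sided inverse is treated, with possibly different ranks; unitarity uses it
  once in each order.\<close>

lemma mat_act_inverse:
  assumes "\<And>i j. i \<in> {1..n} \<Longrightarrow> j \<in> {1..n} \<Longrightarrow>
      (\<Sum>k=1..m. a i k o\<^sub>L b k j) = (if i = j then id_blinfun else 0)"
    and x: "x \<in> carrier (free_module D n)"
  shows "mat_act m n a (mat_act n m b x) = x"
\<comment> \<open>Module elements are undefined outside \<open>{1..n}\<close>, so comparing the
  coordinates in that range decides equality.\<close>
proof (rule PiE_ext[where k = "{1..n}" and s = "\<lambda>_. UNIV"])
  show "mat_act m n a (mat_act n m b x) \<in> {1..n} \<rightarrow>\<^sub>E UNIV"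
    by (auto simp: mat_act_def)
  show "x \<in> {1..n} \<rightarrow>\<^sub>E UNIV"
    using x by (auto simp: carrier_free_module)
  fix i assume i: "i \<in> {1..n}"
  have "mat_act m n a (mat_act n m b x) i = (\<Sum>k=1..m. \<Sum>j=1..n. a i k o\<^sub>L (b k j o\<^sub>L x j))"
    using i by (simp add: mat_act_def blinfun_compose_sum_right)
  also have "\<dots> = (\<Sum>j=1..n. (\<Sum>k=1..m. a i k o\<^sub>L b k j) o\<^sub>L x j)"
    by (subst sum.swap) (simp add: blinfun_compose_sum_left blinfun_compose_assoc)
  also have "\<dots> = (\<Sum>j=1..n. if i = j then x j else 0)"
    using i by (intro sum.cong) (simp_all only: assms(1) compose_delta_left)
  finally show "mat_act m n a (mat_act n m b x) i = x i"
    using i by simp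
qed

text \<open>The adjoint is the conjugate transpose: adjoints reverse each product
  \<open>u i j o\<^sub>L x j\<close>, and the two sums are interchanged.\<close>

lemma mat_act_adjoint:
  assumes u: "\<And>i j. i \<in> {1..m} \<Longrightarrow> j \<in> {1..n} \<Longrightarrow> u i j \<in> commutant A"
  shows "is_adjoint (free_module D n) (free_module D m) (mat_act n m u)
      (mat_act m n (\<lambda>j i. op_adj (u i j)))"
  unfolding is_adjoint_def
proof (intro conjI funcsetI ballI)
  show S: "mat_act m n (\<lambda>j i. op_adj (u i j)) y \<in> carrier (free_module D n)"
    if "y \<in> carrier (free_module D m)" for y
    using u that by (intro mat_act_carrier adj_closed)
  fix x y assume x: "x \<in> carrier (free_module D n)" and y: "y \<in> carrier (free_module D m)"
  have cl: "clinear_op (u i j)" "clinear_op (x j)" if "i \<in> {1..m}" "j \<in> {1..n}" for i j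
    using u free_module_coord[OF x] that by (auto intro: commutant_clinear)
  have adj_row: "op_adj (\<Sum>j=1..n. u i j o\<^sub>L x j) = (\<Sum>j=1..n. op_adj (x j) o\<^sub>L op_adj (u i j))"
    if i: "i \<in> {1..m}" for i
    using op_adj_sum[of "{1..n}" "\<lambda>j. u i j o\<^sub>L x j"] cl[OF i]
    by (simp add: clinear_op_compose op_adj_compose)
  have "ip (free_module D m) (mat_act n m u x) y
      = (\<Sum>i=1..m. op_adj (mat_act n m u x i) o\<^sub>L y i)"
    using u x y by (intro free_module_ip mat_act_carrier)
  also have "\<dots> = (\<Sum>i=1..m. \<Sum>j=1..n. op_adj (x j) o\<^sub>L (op_adj (u i j) o\<^sub>L y i))"
    by (rule sum.cong)
      (simp_all add: mat_act_def adj_row blinfun_compose_sum_left blinfun_compose_assoc del: One_nat_def)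
  also have "\<dots> = (\<Sum>j=1..n. op_adj (x j) o\<^sub>L mat_act m n (\<lambda>j i. op_adj (u i j)) y j)"
    by (subst sum.swap) (simp add: mat_act_def blinfun_compose_sum_right)
  also have "\<dots> = ip (free_module D n) x (mat_act m n (\<lambda>j i. op_adj (u i j)) y)"
    using x S[OF y] by (rule free_module_ip[symmetric])
  finally show "ip (free_module D m) (mat_act n m u x) y
      = ip (free_module D n) x (mat_act m n (\<lambda>j i. op_adj (u i j)) y)" .
qed

text \<open>The last two hypotheses say \<open>u* u = 1\<close> and \<open>u u* = 1\<close>, so the
  conjugate transpose is an adjoint and a two-sided inverse at once.\<close>

lemma mat_act_unitary:
  assumes u: "\<And>i j. i \<in> {1..m} \<Longrightarrow> j \<in> {1..n} \<Longrightarrow> u i j \<in> commutant A"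
    and "\<And>i j. i \<in> {1..n} \<Longrightarrow> j \<in> {1..n} \<Longrightarrow>
      (\<Sum>k=1..m. op_adj (u k i) o\<^sub>L u k j) = (if i = j then id_blinfun else 0)"
    and "\<And>i j. i \<in> {1..m} \<Longrightarrow> j \<in> {1..m} \<Longrightarrow>
      (\<Sum>k=1..n. u i k o\<^sub>L op_adj (u j k)) = (if i = j then id_blinfun else 0)"
  shows "mat_act n m u \<in> unitary_maps D (free_module D n) (free_module D m)"
  unfolding unitary_maps_def adjointable_def
  using mat_act_hom[where m = m and n = n and u = u, OF u] mat_act_adjoint[where m = m and n = n and u = u, OF u]
    mat_act_inverse[where n = n and m = m and a = "\<lambda>j i. op_adj (u i j)" and b = u, OF assms(2)]
    mat_act_inverse[where n = m and m = n and a = u and b = "\<lambda>j i. op_adj (u i j)", OF assms(3)]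
  by (intro CollectI conjI exI[of _ "mat_act m n (\<lambda>j i. op_adj (u i j))"]) blast+

section \<open>Families of isometries and the endomorphisms they implement\<close>

text \<open>Sandwich the common value of the two sums at \<open>a\<close> between the adjoint of
  \<open>W i\<close> and \<open>V j\<close>. Read through \<open>V\<close> it equals the product
  with \<open>a\<close> on the right, read through \<open>W\<close> the product with
  \<open>a\<close> on the left.\<close>

lemma intertwiner_commutant:
  fixes n m :: nat
  assumes V: "\<And>i. i \<in> {1..n} \<Longrightarrow> clinear_op (V i)"
    "\<And>i j. i \<in> {1..n} \<Longrightarrow> j \<in> {1..n} \<Longrightarrow> op_adj (V i) o\<^sub>L V j = (if i = j then id_blinfun else 0)"
    and W: "\<And>i. i \<in> {1..m} \<Longrightarrow> clinear_op (W i)"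
    "\<And>i j. i \<in> {1..m} \<Longrightarrow> j \<in> {1..m} \<Longrightarrow> op_adj (W i) o\<^sub>L W j = (if i = j then id_blinfun else 0)"
    and eq: "\<And>a. a \<in> A \<Longrightarrow>
      (\<Sum>i=1..n. V i o\<^sub>L a o\<^sub>L op_adj (V i)) = (\<Sum>j=1..m. W j o\<^sub>L a o\<^sub>L op_adj (W j))"
    and ij: "i \<in> {1..m}" "j \<in> {1..n}"
  shows "op_adj (W i) o\<^sub>L V j \<in> commutant A"
  unfolding mem_commutant
proof (intro conjI ballI)
  show "clinear_op (op_adj (W i) o\<^sub>L V j)"
    using V(1) W(1) ij by (intro clinear_op_compose clinear_op_adj)
  fix a assume a: "a \<in> A"
  have 1: "(\<Sum>k=1..n. V k o\<^sub>L a o\<^sub>L op_adj (V k)) o\<^sub>L V j = V j o\<^sub>L a"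
  proof -
    have "(\<Sum>k=1..n. V k o\<^sub>L a o\<^sub>L op_adj (V k)) o\<^sub>L V j
        = (\<Sum>k=1..n. V k o\<^sub>L a o\<^sub>L (op_adj (V k) o\<^sub>L V j))"
      by (simp add: blinfun_compose_sum_left blinfun_compose_assoc)
    also have "\<dots> = (\<Sum>k=1..n. if k = j then V k o\<^sub>L a else 0)"
      using ij by (intro sum.cong) (simp_all only: V(2) compose_delta_right)
    finally show ?thesis using ij by simp
  qed
  have 2: "op_adj (W i) o\<^sub>L (\<Sum>k=1..m. W k o\<^sub>L a o\<^sub>L op_adj (W k)) = a o\<^sub>L op_adj (W i)"
  proof -
    have "op_adj (W i) o\<^sub>L (\<Sum>k=1..m. W k o\<^sub>L a o\<^sub>L op_adj (W k))
        = (\<Sum>k=1..m. op_adj (W i) o\<^sub>L W k o\<^sub>L (a o\<^sub>L op_adj (W k)))"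
      by (simp add: blinfun_compose_sum_right blinfun_compose_assoc)
    also have "\<dots> = (\<Sum>k=1..m. if i = k then a o\<^sub>L op_adj (W k) else 0)"
      using ij by (intro sum.cong) (simp_all only: W(2) compose_delta_left)
    finally show ?thesis using ij by simp
  qed
  show "(op_adj (W i) o\<^sub>L V j) o\<^sub>L a = a o\<^sub>L (op_adj (W i) o\<^sub>L V j)"
  proof -
    have "(op_adj (W i) o\<^sub>L V j) o\<^sub>L a = op_adj (W i) o\<^sub>L (V j o\<^sub>L a)"
      by (rule blinfun_compose_assoc)
    also have "\<dots> = (op_adj (W i) o\<^sub>L (\<Sum>k=1..m. W k o\<^sub>L a o\<^sub>L op_adj (W k))) o\<^sub>L V j"
      by (simp only: blinfun_compose_assoc[of "op_adj (W i)"] flip: 1 eq[OF a])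
    also have "\<dots> = a o\<^sub>L (op_adj (W i) o\<^sub>L V j)"
      unfolding 2 by (rule blinfun_compose_assoc)
    finally show ?thesis .
  qed
qed

text \<open>The sum is the projection onto the span of the orthogonal ranges, so it fixes each
  \<open>V j\<close>; orthogonality leaves only the term \<open>k = j\<close>.\<close>

lemma range_projection_absorb:
  assumes "\<And>i j. i \<in> {1..n} \<Longrightarrow> j \<in> {1..n} \<Longrightarrow>
      op_adj (V i) o\<^sub>L V j = (if i = j then id_blinfun else 0)"
    and j: "j \<in> {1..n::nat}"
  shows "(\<Sum>k=1..n. V k o\<^sub>L op_adj (V k)) o\<^sub>L V j = V j"
proof -
  have "(\<Sum>k=1..n. V k o\<^sub>L op_adj (V k)) o\<^sub>L V j = (\<Sum>k=1..n. V k o\<^sub>L (op_adj (V k) o\<^sub>L V j))"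
    by (simp add: blinfun_compose_sum_left blinfun_compose_assoc)
  also have "\<dots> = (\<Sum>k=1..n. if k = j then V k else 0)"
    using j by (intro sum.cong) (simp_all only: assms(1) compose_delta_right)
  finally show ?thesis using j by simp
qed

text \<open>The ranks may differ here, which is what allows IBN to be applied to the resulting
  unitary.\<close>

lemma implementing_unitary:
  assumes V: "\<And>i. i \<in> {1..n} \<Longrightarrow> clinear_op (V i)"
    "\<And>i j. i \<in> {1..n} \<Longrightarrow> j \<in> {1..n} \<Longrightarrow> op_adj (V i) o\<^sub>L V j = (if i = j then id_blinfun else 0)"
    and W: "\<And>i. i \<in> {1..m} \<Longrightarrow> clinear_op (W i)"
    "\<And>i j. i \<in> {1..m} \<Longrightarrow> j \<in> {1..m} \<Longrightarrow> op_adj (W i) o\<^sub>L W j = (if i = j then id_blinfun else 0)"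
    and eq: "\<And>a. a \<in> A \<Longrightarrow>
      (\<Sum>i=1..n. V i o\<^sub>L a o\<^sub>L op_adj (V i)) = (\<Sum>j=1..m. W j o\<^sub>L a o\<^sub>L op_adj (W j))"
    and one: "id_blinfun \<in> A"
  shows "\<exists>U \<in> unitary_maps D (free_module D n) (free_module D m).
    \<forall>x \<in> carrier (free_module D n). (\<Sum>i=1..n. V i o\<^sub>L x i) = (\<Sum>i=1..m. W i o\<^sub>L U x i)"
proof -
  define u where "u i j = op_adj (W i) o\<^sub>L V j" for i j
  have u: "u i j \<in> commutant A" if "i \<in> {1..m}" "j \<in> {1..n}" for i j
    unfolding u_def by (rule intertwiner_commutant[OF V W eq that])
  have u_adj: "op_adj (u i j) = op_adj (V j) o\<^sub>L W i" if "i \<in> {1..m}" "j \<in> {1..n}" for i j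
    using that V(1) W(1) by (simp add: u_def op_adj_compose op_adj_adj clinear_op_adj)
  \<comment> \<open>Evaluating the hypothesis at the identity shows that the two families have the
    same range projection. Each projection therefore absorbs the isometries of the other
    family.\<close>
  have P: "(\<Sum>i=1..n. V i o\<^sub>L op_adj (V i)) = (\<Sum>i=1..m. W i o\<^sub>L op_adj (W i))"
    using eq[OF one] by (simp add: blinfun_compose_id)
  have PV: "(\<Sum>k=1..m. W k o\<^sub>L op_adj (W k)) o\<^sub>L V j = V j" if "j \<in> {1..n}" for j
    using range_projection_absorb[OF V(2) that] P by simp
  have PW: "(\<Sum>k=1..n. V k o\<^sub>L op_adj (V k)) o\<^sub>L W j = W j" if "j \<in> {1..m}" for j
    using range_projection_absorb[OF W(2) that] P by simp
  have "mat_act n m u \<in> unitary_maps D (free_module D n) (free_module D m)"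
  proof (rule mat_act_unitary[OF u])
    fix i j assume ij: "i \<in> {1..n}" "j \<in> {1..n}"
    have "(\<Sum>k=1..m. op_adj (u k i) o\<^sub>L u k j) = (\<Sum>k=1..m. op_adj (V i) o\<^sub>L W k o\<^sub>L u k j)"
      using ij by (intro sum.cong) (simp_all only: u_adj)
    also have "\<dots> = op_adj (V i) o\<^sub>L ((\<Sum>k=1..m. W k o\<^sub>L op_adj (W k)) o\<^sub>L V j)"
      by (simp add: u_def blinfun_compose_sum_left blinfun_compose_sum_right blinfun_compose_assoc)
    finally show "(\<Sum>k=1..m. op_adj (u k i) o\<^sub>L u k j) = (if i = j then id_blinfun else 0)"
      by (simp only: PV V(2) ij)
  next
    fix i j assume ij: "i \<in> {1..m}" "j \<in> {1..m}"
    have "(\<Sum>k=1..n. u i k o\<^sub>L op_adj (u j k)) = (\<Sum>k=1..n. u i k o\<^sub>L (op_adj (V k) o\<^sub>L W j))"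
      using ij by (intro sum.cong) (simp_all only: u_adj)
    also have "\<dots> = op_adj (W i) o\<^sub>L ((\<Sum>k=1..n. V k o\<^sub>L op_adj (V k)) o\<^sub>L W j)"
      by (simp add: u_def blinfun_compose_sum_left blinfun_compose_sum_right blinfun_compose_assoc)
    finally show "(\<Sum>k=1..n. u i k o\<^sub>L op_adj (u j k)) = (if i = j then id_blinfun else 0)"
      by (simp only: PW W(2) ij)
  qed auto
  moreover have "(\<Sum>i=1..n. V i o\<^sub>L x i) = (\<Sum>i=1..m. W i o\<^sub>L mat_act n m u x i)" for x
  proof -
    have "(\<Sum>i=1..m. W i o\<^sub>L mat_act n m u x i)
        = (\<Sum>j=1..n. (\<Sum>k=1..m. W k o\<^sub>L op_adj (W k)) o\<^sub>L V j o\<^sub>L x j)"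
      unfolding blinfun_compose_sum_left
      by (subst sum.swap)
        (simp add: mat_act_def u_def blinfun_compose_sum_right blinfun_compose_assoc)
    also have "\<dots> = (\<Sum>j=1..n. V j o\<^sub>L x j)"
      by (intro sum.cong) (simp_all only: PV)
    finally show ?thesis by simp
  qed
  ultimately show ?thesis by blast
qed

text \<open>Recovers a matrix from an abstract module unitary by pairing with basis vectors. The
  last clause is \<open>u u* = 1\<close> for the matrix \<open>u\<close> of \<open>U\<close>, with
  entries \<open>op_adj (b i j)\<close>, and comes from \<open>U\<close> inverting its adjoint on
  the left.\<close>

lemma unitary_coordinates:
  assumes "U \<in> unitary_maps D (free_module D n) (free_module D m)"
  shows "\<exists>b. (\<forall>i\<in>{1..m}. \<forall>j\<in>{1..n}. b i j \<in> commutant A) \<and>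
    (\<forall>i\<in>{1..m}. \<forall>j\<in>{1..n}. U (std_basis D n j) i = op_adj (b i j)) \<and>
    (\<forall>i\<in>{1..m}. \<forall>k\<in>{1..m}.
      (\<Sum>j=1..n. op_adj (b i j) o\<^sub>L b k j) = (if i = k then id_blinfun else 0))"
proof -
  let ?X = "free_module D n" and ?Y = "free_module D m"
  from assms obtain S where "U \<in> module_hom D ?X ?Y" and S': "is_adjoint ?X ?Y U S"
    and US: "\<And>y. y \<in> carrier ?Y \<Longrightarrow> U (S y) = y"
    unfolding unitary_maps_def adjointable_def by clarsimp
  then have U: "\<And>x. x \<in> carrier ?X \<Longrightarrow> U x \<in> carrier ?Y"
    unfolding module_hom_def by blast
  have S: "S \<in> carrier ?Y \<rightarrow> carrier ?X"
    and adj: "\<And>x y. x \<in> carrier ?X \<Longrightarrow> y \<in> carrier ?Y \<Longrightarrow> ip ?Y (U x) y = ip ?X x (S y)"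
    using S' unfolding is_adjoint_def by blast+
  \<comment> \<open>\<open>S\<close> is the adjoint of \<open>U\<close>, so \<open>b\<close> is the entrywise adjoint of the matrix of \<open>U\<close>.\<close>
  define b where "b i j = S (std_basis D m i) j" for i j
  have Sc: "S (std_basis D m i) \<in> carrier ?X" for i
    using S std_basis_carrier by auto
  have b: "b i j \<in> commutant A" if "j \<in> {1..n}" for i j
    unfolding b_def by (rule free_module_coord[OF Sc that])
  have Ux: "U x i = (\<Sum>j=1..n. op_adj (b i j) o\<^sub>L x j)"
    if x: "x \<in> carrier ?X" and i: "i \<in> {1..m}" for x i
  proof -
    have cl: "clinear_op (x j)" "clinear_op (b i j)" if "j \<in> {1..n}" for j
      using free_module_coord[OF x that] b[OF that] by (auto intro: commutant_clinear)
    have "op_adj (U x i) = ip ?Y (U x) (std_basis D m i)"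
      using U[OF x] i by (simp only: ip_std_basis_right)
    also have "\<dots> = (\<Sum>j=1..n. op_adj (x j) o\<^sub>L b i j)"
      unfolding b_def using x by (simp only: adj std_basis_carrier free_module_ip Sc)
    \<comment> \<open>The pairing yields the adjoint of the coordinate, so a second adjoint is
      taken.\<close>
    finally have "op_adj (op_adj (U x i)) = (\<Sum>j=1..n. op_adj (op_adj (x j) o\<^sub>L b i j))"
      using op_adj_sum[of "{1..n}" "\<lambda>j. op_adj (x j) o\<^sub>L b i j"] cl
      by (simp add: clinear_op_compose clinear_op_adj)
    also have "\<dots> = (\<Sum>j=1..n. op_adj (b i j) o\<^sub>L x j)"
      using cl by (intro sum.cong) (simp_all add: op_adj_compose clinear_op_adj op_adj_adj)
    finally show ?thesis
      using free_module_coord[OF U[OF x] i] by (simp add: op_adj_adj commutant_clinear)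
  qed
  show ?thesis
  proof (intro exI[of _ b] conjI ballI)
    show "b i j \<in> commutant A" if "i \<in> {1..m}" "j \<in> {1..n}" for i j
      using that(2) by (rule b)
    show "U (std_basis D n j) i = op_adj (b i j)" if "i \<in> {1..m}" "j \<in> {1..n}" for i j
    proof -
      have "U (std_basis D n j) i = (\<Sum>k=1..n. if k = j then op_adj (b i k) else 0)"
        unfolding Ux[OF std_basis_carrier that(1)]
        by (intro sum.cong) (simp_all only: std_basis_apply compose_delta_right)
      then show ?thesis using that by simp
    qed
    \<comment> \<open>Apply the coordinate formula to the image of the \<open>k\<close>-th basis
      vector under \<open>S\<close>, which \<open>U\<close> sends back to that vector.\<close>
    show "(\<Sum>j=1..n. op_adj (b i j) o\<^sub>L b k j) = (if i = k then id_blinfun else 0)"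
      if "i \<in> {1..m}" "k \<in> {1..m}" for i k
      using Ux[OF Sc that(1), of k] that
      by (simp only: US std_basis_carrier std_basis_apply b_def)
  qed
qed

text \<open>Substituting the expansion of \<open>V j\<close> in the \<open>W i\<close> leaves the
  matrix entries around \<open>a\<close>; they commute with \<open>a\<close>, and summing over
  \<open>j\<close> reduces them to a delta.\<close>

lemma endo_eq_of_unitary:
  assumes V: "\<And>i. i \<in> {1..n} \<Longrightarrow> clinear_op (V i)"
    and W: "\<And>i. i \<in> {1..m} \<Longrightarrow> clinear_op (W i)"
    and U: "U \<in> unitary_maps D (free_module D n) (free_module D m)"
    and sig: "\<And>x. x \<in> carrier (free_module D n) \<Longrightarrow>
      (\<Sum>i=1..n. V i o\<^sub>L x i) = (\<Sum>i=1..m. W i o\<^sub>L U x i)"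
    and a: "a \<in> A"
  shows "(\<Sum>i=1..n. V i o\<^sub>L a o\<^sub>L op_adj (V i)) = (\<Sum>j=1..m. W j o\<^sub>L a o\<^sub>L op_adj (W j))"
proof -
  obtain b where b: "\<forall>i\<in>{1..m}. \<forall>j\<in>{1..n}. b i j \<in> commutant A"
    and Ub: "\<forall>i\<in>{1..m}. \<forall>j\<in>{1..n}. U (std_basis D n j) i = op_adj (b i j)"
    and bb: "\<forall>i\<in>{1..m}. \<forall>k\<in>{1..m}.
      (\<Sum>j=1..n. op_adj (b i j) o\<^sub>L b k j) = (if i = k then id_blinfun else 0)"
    using unitary_coordinates[OF U] by (elim exE conjE)
  note b = b[rule_format] and Ub = Ub[rule_format] and bb = bb[rule_format]
  have cl: "clinear_op (b i j)" if "i \<in> {1..m}" "j \<in> {1..n}" for i j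
    using b[OF that] by (rule commutant_clinear)
  \<comment> \<open>Evaluating \<open>sig\<close> at the \<open>j\<close>-th basis vector isolates
    \<open>V j\<close>.\<close>
  have Vj: "V j = (\<Sum>i=1..m. W i o\<^sub>L op_adj (b i j))" if j: "j \<in> {1..n}" for j
  proof -
    have "(\<Sum>i=1..n. V i o\<^sub>L std_basis D n j i) = (\<Sum>i=1..n. if i = j then V i else 0)"
      by (intro sum.cong) (simp_all only: std_basis_apply compose_delta_right)
    then have "V j = (\<Sum>i=1..n. V i o\<^sub>L std_basis D n j i)"
      using j by simp
    also have "\<dots> = (\<Sum>i=1..m. W i o\<^sub>L op_adj (b i j))"
      unfolding sig[OF std_basis_carrier] using j by (intro sum.cong) (simp_all only: Ub)
    finally show ?thesis .
  qed
  have Vj': "op_adj (V j) = (\<Sum>k=1..m. b k j o\<^sub>L op_adj (W k))" if j: "j \<in> {1..n}" for j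
  proof -
    have "op_adj (V j) = (\<Sum>k=1..m. op_adj (W k o\<^sub>L op_adj (b k j)))"
      unfolding Vj[OF j] using op_adj_sum[of "{1..m}" "\<lambda>k. W k o\<^sub>L op_adj (b k j)"] W cl[OF _ j]
      by (simp add: clinear_op_compose clinear_op_adj)
    also have "\<dots> = (\<Sum>k=1..m. b k j o\<^sub>L op_adj (W k))"
      using W cl[OF _ j]
      by (intro sum.cong) (simp_all add: op_adj_compose clinear_op_adj op_adj_adj)
    finally show ?thesis .
  qed
  \<comment> \<open>The trailing factor \<open>T\<close> lets the commutation act inside products
    associated to the right.\<close>
  have comm: "op_adj (b i j) o\<^sub>L (a o\<^sub>L T) = a o\<^sub>L (op_adj (b i j) o\<^sub>L T)"
    if "i \<in> {1..m}" "j \<in> {1..n}" for i j T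
  proof -
    have "op_adj (b i j) o\<^sub>L a = a o\<^sub>L op_adj (b i j)"
      using adj_closed[OF b[OF that]] a unfolding mem_commutant by blast
    then show ?thesis by (simp only: flip: blinfun_compose_assoc)
  qed
  have "(\<Sum>j=1..n. V j o\<^sub>L a o\<^sub>L op_adj (V j))
      = (\<Sum>j=1..n. \<Sum>i=1..m. \<Sum>k=1..m. W i o\<^sub>L (op_adj (b i j) o\<^sub>L (a o\<^sub>L (b k j o\<^sub>L op_adj (W k)))))"
    by (rule sum.cong[OF refl], subst Vj', assumption, subst Vj, assumption)
      (simp add: blinfun_compose_sum_left blinfun_compose_sum_right blinfun_compose_assoc,
        rule sum.swap)
  also have "\<dots> = (\<Sum>j=1..n. \<Sum>i=1..m. \<Sum>k=1..m.
      W i o\<^sub>L (a o\<^sub>L (op_adj (b i j) o\<^sub>L (b k j o\<^sub>L op_adj (W k)))))"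
    by (intro sum.cong refl) (simp only: comm)
  \<comment> \<open>The sum over \<open>j\<close> moves innermost, where the row relation
    \<open>bb\<close> applies.\<close>
  also have "\<dots> = (\<Sum>i=1..m. \<Sum>k=1..m. \<Sum>j=1..n.
      W i o\<^sub>L (a o\<^sub>L (op_adj (b i j) o\<^sub>L (b k j o\<^sub>L op_adj (W k)))))"
    by (subst sum.swap, rule sum.cong[OF refl], rule sum.swap)
  also have "\<dots> = (\<Sum>i=1..m. \<Sum>k=1..m.
      W i o\<^sub>L (a o\<^sub>L ((\<Sum>j=1..n. op_adj (b i j) o\<^sub>L b k j) o\<^sub>L op_adj (W k))))"
    by (simp add: blinfun_compose_sum_left blinfun_compose_sum_right blinfun_compose_assoc)
  also have "\<dots> = (\<Sum>i=1..m. \<Sum>k=1..m. if i = k then W i o\<^sub>L (a o\<^sub>L op_adj (W k)) else 0)"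
    by (intro sum.cong refl) (simp only: bb compose_delta_left if_distrib[of "\<lambda>T. _ o\<^sub>L T"] blinfun_compose_zero)
  also have "\<dots> = (\<Sum>i=1..m. W i o\<^sub>L a o\<^sub>L op_adj (W i))"
    by (simp add: blinfun_compose_assoc)
  finally show ?thesis .
qed

end

section \<open>Representations of the Toeplitz algebra\<close>

lemma star_hom_bounded_opsD:
  fixes \<omega> :: "'e \<Rightarrow> ('h::complex_hilbert \<Rightarrow>\<^sub>L 'h)"
  assumes "\<omega> \<in> star_hom E bounded_ops"
  shows "a \<in> carrier E \<Longrightarrow> clinear_op (\<omega> a)"
    and "a \<in> carrier E \<Longrightarrow> b \<in> carrier E \<Longrightarrow> \<omega> (a \<otimes>\<^bsub>E\<^esub> b) = \<omega> a o\<^sub>L \<omega> b"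
    and "a \<in> carrier E \<Longrightarrow> b \<in> carrier E \<Longrightarrow> \<omega> (a \<oplus>\<^bsub>E\<^esub> b) = \<omega> a + \<omega> b"
    and "a \<in> carrier E \<Longrightarrow> \<omega> (star E a) = op_adj (\<omega> a)"
proof -
  let ?B = "bounded_ops :: ('h \<Rightarrow>\<^sub>L 'h) cstar"
  have "carrier ?B = Collect clinear_op" "mult ?B = (o\<^sub>L)" "add ?B = (+)" "star ?B = op_adj"
    by (simp_all add: carrier_bounded_ops) (simp_all add: bounded_ops_def)
  then show "a \<in> carrier E \<Longrightarrow> clinear_op (\<omega> a)"
    and "a \<in> carrier E \<Longrightarrow> b \<in> carrier E \<Longrightarrow> \<omega> (a \<otimes>\<^bsub>E\<^esub> b) = \<omega> a o\<^sub>L \<omega> b"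
    and "a \<in> carrier E \<Longrightarrow> b \<in> carrier E \<Longrightarrow> \<omega> (a \<oplus>\<^bsub>E\<^esub> b) = \<omega> a + \<omega> b"
    and "a \<in> carrier E \<Longrightarrow> \<omega> (star E a) = op_adj (\<omega> a)"
    using assms by (auto simp: star_hom_def hom_def)
qed

text \<open>Members of \<open>star_hom\<close> need not be unital. The fixed vectors of the image of
  the unit form a closed subspace containing all \<open>\<omega> a x\<close>, and these span a dense
  subspace.\<close>

lemma nondegenerate_rep_one:
  assumes "unital_cstar_algebra E" "nondegenerate_rep E \<omega>"
  shows "\<omega> \<one>\<^bsub>E\<^esub> = id_blinfun"
proof -
  interpret E: unital_cstar_algebra E by fact
  have hom: "\<omega> \<in> star_hom E bounded_ops"
    and dense: "closure (span {\<omega> a x | a x. a \<in> carrier E}) = UNIV"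
    using assms(2) by (auto simp: nondegenerate_rep_def)
  let ?F = "{x. \<omega> \<one>\<^bsub>E\<^esub> x = x}"
  have "subspace ?F"
    by (auto simp: subspace_def blinfun.add_right blinfun.scaleR_right)
  moreover have "{\<omega> a x | a x. a \<in> carrier E} \<subseteq> ?F"
  proof clarify
    fix a x assume "a \<in> carrier E"
    then have "\<omega> \<one>\<^bsub>E\<^esub> o\<^sub>L \<omega> a = \<omega> a"
      using star_hom_bounded_opsD(2)[OF hom E.one_closed] E.l_one by metis
    then show "\<omega> \<one>\<^bsub>E\<^esub> (\<omega> a x) = \<omega> a x"
      by (metis blinfun_apply_blinfun_compose)
  qed
  moreover have "closed ?F"
    by (intro closed_Collect_eq continuous_intros)
  ultimately have "closure (span {\<omega> a x | a x. a \<in> carrier E}) \<subseteq> ?F"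
    by (intro closure_minimal span_minimal)
  then have "?F = UNIV" using dense by blast
  then show ?thesis by (intro blinfun_eqI) auto
qed

text \<open>The relations pass through \<open>\<omega>\<close>; nondegeneracy makes the image of the
  unit the identity, so the images of the generators are isometries.\<close>

lemma toeplitz_rep_isometries:
  assumes "is_toeplitz_algebra n E v" "nondegenerate_rep E \<omega>"
  shows "i \<in> {1..n} \<Longrightarrow> clinear_op (\<omega> (v i))"
    and "i \<in> {1..n} \<Longrightarrow> j \<in> {1..n} \<Longrightarrow>
      op_adj (\<omega> (v i)) o\<^sub>L \<omega> (v j) = (if i = j then id_blinfun else 0)"
proof -
  have E: "unital_cstar_algebra E" and rel: "toeplitz_relations E n v"
    using assms(1) by (auto simp: is_toeplitz_algebra_def)
  interpret E: unital_cstar_algebra E by (rule E)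
  have hom: "\<omega> \<in> star_hom E bounded_ops" using assms(2) by (simp add: nondegenerate_rep_def)
  note h = star_hom_bounded_opsD[OF hom]
  have v: "v i \<in> carrier E" if "i \<in> {1..n}" for i
    using rel that by (auto simp: toeplitz_relations_def)
  show "i \<in> {1..n} \<Longrightarrow> clinear_op (\<omega> (v i))" using h(1) v by blast
  have zero: "\<omega> \<zero>\<^bsub>E\<^esub> = 0"
    using h(3)[OF E.zero_closed E.zero_closed] unfolding E.l_zero[OF E.zero_closed] by simp
  show "op_adj (\<omega> (v i)) o\<^sub>L \<omega> (v j) = (if i = j then id_blinfun else 0)"
    if ij: "i \<in> {1..n}" "j \<in> {1..n}"
  proof -
    have "op_adj (\<omega> (v i)) o\<^sub>L \<omega> (v j) = \<omega> (star E (v i) \<otimes>\<^bsub>E\<^esub> v j)"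
      using v ij by (simp only: h E.star_closed)
    also have "star E (v i) \<otimes>\<^bsub>E\<^esub> v j = (if i = j then \<one>\<^bsub>E\<^esub> else \<zero>\<^bsub>E\<^esub>)"
      using rel ij by (auto simp: toeplitz_relations_def)
    finally show ?thesis
      using nondegenerate_rep_one[OF E assms(2)] zero by simp
  qed
qed

section \<open>The equivalence of the two conditions\<close>

theorem theorem4p3:
  fixes A :: "('h::complex_hilbert \<Rightarrow>\<^sub>L 'h) set"
    and n m :: nat
    and E :: "nat \<Rightarrow> 'e cstar"
    and v :: "nat \<Rightarrow> nat \<Rightarrow> 'e"
    and \<omega> \<tau> :: "'e \<Rightarrow> ('h \<Rightarrow>\<^sub>L 'h)"
  assumes "n \<ge> 1" and "m \<ge> 1"
    and "is_toeplitz_algebra n (E n) (v n)"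
    and "is_toeplitz_algebra m (E m) (v m)"
    and "unital_cstar_subalgebra A bounded_ops"
    and "nondegenerate_rep (E n) \<omega>"
    and "nondegenerate_rep (E m) \<tau>"
    and "rep_endo n (v n) \<omega> \<in> star_hom (op_alg A) (op_alg A)"
    and "rep_endo m (v m) \<tau> \<in> star_hom (op_alg A) (op_alg A)"
    and "IBN (op_alg (commutant A))"
  shows "(\<forall>a\<in>A. rep_endo n (v n) \<omega> a = rep_endo m (v m) \<tau> a) \<longleftrightarrow>
         n = m \<and> free_equivalent (op_alg (commutant A)) n (v n) \<omega> \<tau>"
proof -
  have sub: "unital_cstar_subalgebra A bounded_ops" by fact
  have one: "id_blinfun \<in> A"
    using sub subringE(3)[of A bounded_ops] by (simp add: unital_cstar_subalgebra_def bounded_ops_def)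
  interpret star_closed_ops A
  proof
    show "clinear_op S" if "S \<in> A" for S
      using sub that subringE(1)[of A bounded_ops]
      by (auto simp: unital_cstar_subalgebra_def carrier_bounded_ops)
    show "op_adj S \<in> A" if "S \<in> A" for S
      using sub that by (simp add: unital_cstar_subalgebra_def bounded_ops_def)
  qed
  note V = toeplitz_rep_isometries[OF assms(3,6)]
  note W = toeplitz_rep_isometries[OF assms(4,7)]
  show ?thesis
  proof
    assume "\<forall>a\<in>A. rep_endo n (v n) \<omega> a = rep_endo m (v m) \<tau> a"
    then have "\<exists>U \<in> unitary_maps D (free_module D n) (free_module D m).
        \<forall>x \<in> carrier (free_module D n).
          (\<Sum>i=1..n. \<omega> (v n i) o\<^sub>L x i) = (\<Sum>i=1..m. \<tau> (v m i) o\<^sub>L U x i)"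
      by (intro implementing_unitary[OF V W _ one]) (auto simp: rep_endo_def)
    then obtain U where U: "U \<in> unitary_maps D (free_module D n) (free_module D m)"
      and sig: "\<And>x. x \<in> carrier (free_module D n) \<Longrightarrow>
          (\<Sum>i=1..n. \<omega> (v n i) o\<^sub>L x i) = (\<Sum>i=1..m. \<tau> (v m i) o\<^sub>L U x i)"
      by blast
    \<comment> \<open>The unitary between the free modules of ranks \<open>n\<close> and
      \<open>m\<close> is exactly what IBN excludes for different ranks.\<close>
    have nm: "n = m"
      using \<open>IBN D\<close> U \<open>n \<ge> 1\<close> \<open>m \<ge> 1\<close> by (auto simp: IBN_def)
    have "U x \<in> carrier (free_module D m)" if "x \<in> carrier (free_module D n)" for x
      using U that by (auto simp: unitary_maps_def adjointable_def module_hom_def)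
    then show "n = m \<and> free_equivalent D n (v n) \<omega> \<tau>"
      using U sig nm unfolding free_equivalent_def
      by (auto simp: rep_sigma_eq intro!: bexI[of _ U])
  next
    assume eq: "n = m \<and> free_equivalent D n (v n) \<omega> \<tau>"
    \<comment> \<open>Since \<open>n = m\<close>, the data of \<open>\<tau>\<close> can be written
      with index \<open>m\<close>, matching the lemma for two ranks.\<close>
    then obtain U where U: "U \<in> unitary_maps D (free_module D n) (free_module D m)"
      and sig: "\<And>x. x \<in> carrier (free_module D n) \<Longrightarrow>
        rep_sigma D n (v n) \<omega> x = rep_sigma D m (v m) \<tau> (U x)"
      by (auto simp: free_equivalent_def)
    have Ux: "U x \<in> carrier (free_module D m)" if "x \<in> carrier (free_module D n)" for x
      using U that by (auto simp: unitary_maps_def adjointable_def module_hom_def)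
    show "\<forall>a\<in>A. rep_endo n (v n) \<omega> a = rep_endo m (v m) \<tau> a"
      unfolding rep_endo_def
    proof (intro ballI endo_eq_of_unitary[OF V(1) W(1) U])
      show "(\<Sum>i=1..n. \<omega> (v n i) o\<^sub>L x i) = (\<Sum>i=1..m. \<tau> (v m i) o\<^sub>L U x i)"
        if "x \<in> carrier (free_module D n)" for x
        using sig[OF that] that Ux[OF that] by (simp only: rep_sigma_eq)
    qed
  qed
qed

end
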